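(* Let $\phi:\mathbb{R}\to\mathbb{R}$ be a convex function and let $G,G'\in\overline{\mathcal{G}}(\Theta)$ be such that both $\rho_\phi(p_G,p_{G'})$ and $d_{\rho_\phi}(G,G')$ are finite. Then $$\rho_\phi(p_G,p_{G'})\le d_{\rho_\phi}(G,G').$$
   Context: $\{f(\cdot|\theta),\theta\in\Theta\}$ is a family of probability densities on $\mathcal{X}$ with respect to a dominating measure $\mu$. $\overline{\mathcal{G}}(\Theta)$ is the set of all discrete probability measures on $\Theta$ with finite or countably infinite support. For $G=\sum_{i}p_i\delta_{\theta_i}$ and $G'=\sum_jp'_j\delta_{\theta'_j}$ write $f_i=f(\cdot|\theta_i)$, $f'_j=f(\cdot|\theta'_j)$, $p_G=\sum_ip_if_i$, $p_{G'}=\sum_jp'_jf'_j$. The $f$-divergence (Ali–Silvey distance) associated with $\phi$ is $\rho_\phi(p,q)=\int\phi(q/p)\,p\,d\mu$ for probability densities $p,q$; so $\rho_\phi(f_i,f'_j)=\int\phi(f'_j/f_i)f_i\,d\mu$ and $\rho_\phi(p_G,p_{G'})=\int\phi(p_{G'}/p_G)p_G\,d\mu$. The composite transportation distance is $$d_{\rho_\phi}(G,G')=\inf_{q}\sum_{i,j}q_{ij}\,\rho_\phi(f_i,f'_j),$$ the infimum over all couplings $q=(q_{ij})$, i.e. joint probability distributions with $\sum_jq_{ij}=p_i$ and $\sum_iq_{ij}=p'_j$. *)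

theory Defs
  imports "HOL-Probability.Probability"
begin

text \<open>
  Integral of an extended-real-valued function as the integral of the positive part minus that of
  the negative part. In every use below the negative part has finite integral (for convex
  \<open>\<phi>\<close>, probability densities and probability weights), so the value is a
  well-defined element of \<open>(-\<infinity>, \<infinity>]\<close>.
\<close>

definition ext_integral :: "'a measure \<Rightarrow> ('a \<Rightarrow> ereal) \<Rightarrow> ereal" where
  "ext_integral M g =
     enn2ereal (\<integral>\<^sup>+ x. e2ennreal (g x) \<partial>M) - enn2ereal (\<integral>\<^sup>+ x. e2ennreal (- g x) \<partial>M)"

lemma ext_integral_integrable:
  assumes "integrable M g"
  shows "ext_integral M (\<lambda>x. ereal (g x)) = ereal (\<integral>x. g x \<partial>M)"
proof -
  have "integrable M (\<lambda>x. - g x)" using assms by simp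
  then have fin: "(\<integral>\<^sup>+ x. ennreal (g x) \<partial>M) \<noteq> \<infinity>" "(\<integral>\<^sup>+ x. ennreal (- g x) \<partial>M) \<noteq> \<infinity>"
    using assms unfolding real_integrable_def by auto
  have e: "e2ennreal (ereal r) = ennreal r" for r
    by (simp add: ennreal_def)
  obtain a b where ab: "0 \<le> a" "(\<integral>\<^sup>+ x. ennreal (g x) \<partial>M) = ennreal a"
      "0 \<le> b" "(\<integral>\<^sup>+ x. ennreal (- g x) \<partial>M) = ennreal b"
    using fin by (metis ennreal_cases infinity_ennreal_def)
  then show ?thesis
    using real_lebesgue_integral_def[OF assms] by (simp add: ext_integral_def e enn2ereal_ennreal)
qed

definition prob_density :: "'x measure \<Rightarrow> ('x \<Rightarrow> real) \<Rightarrow> bool" where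
  "prob_density M p \<longleftrightarrow>
     p \<in> borel_measurable M \<and> (\<forall>x\<in>space M. 0 \<le> p x) \<and> (\<integral>\<^sup>+ x. ennreal (p x) \<partial>M) = 1"

text \<open>
  The integrand \<open>\<phi> (q / p) * p\<close> of an \<open>f\<close>-divergence, with the usual
  conventions where \<open>p\<close> vanishes: \<open>0 * \<phi> (0 / 0) = 0\<close> and
  \<open>0 * \<phi> (q / 0) = q * lim (\<phi> t / t)\<close> as \<open>t\<close> tends to
  \<open>\<infinity>\<close>. For convex \<open>\<phi>\<close> the limit exists in
  \<open>(-\<infinity>, \<infinity>]\<close>, and in \<open>ereal\<close> the product
  \<open>0 * \<infinity>\<close> is \<open>0\<close>, which covers the case \<open>p = q = 0\<close>.
  Reading \<open>q / 0\<close> as \<open>0\<close> instead would drop the mass of \<open>q\<close>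
  outside the support of \<open>p\<close>.
\<close>

definition f_div_integrand :: "(real \<Rightarrow> real) \<Rightarrow> real \<Rightarrow> real \<Rightarrow> ereal" where
  "f_div_integrand \<phi> p q =
     (if p = 0 then ereal q * Lim at_top (\<lambda>t. ereal (\<phi> t / t)) else ereal (\<phi> (q / p) * p))"

definition f_divergence ::
    "'x measure \<Rightarrow> (real \<Rightarrow> real) \<Rightarrow> ('x \<Rightarrow> real) \<Rightarrow> ('x \<Rightarrow> real) \<Rightarrow> ereal" where
  "f_divergence M \<phi> p q = ext_integral M (\<lambda>x. f_div_integrand \<phi> (p x) (q x))"

text \<open>
  A discrete probability measure \<open>G\<close> with at most countable support is a \<open>pmf\<close>; its atoms are
  the points of \<open>set_pmf G\<close> and their weights are \<open>pmf G \<theta>\<close>.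
\<close>

definition discrete_measures :: "'t set \<Rightarrow> 't pmf set" where
  "discrete_measures \<Theta> = {G. set_pmf G \<subseteq> \<Theta>}"

text \<open>
  For densities \<open>f \<theta>\<close> the sum converges at almost every \<open>x\<close>; where it
  diverges, \<open>infsum\<close> is \<open>0\<close>.
\<close>

definition mixture_density :: "('t \<Rightarrow> 'x \<Rightarrow> real) \<Rightarrow> 't pmf \<Rightarrow> 'x \<Rightarrow> real" where
  "mixture_density f G x = (\<Sum>\<^sub>\<infinity>\<theta>\<in>set_pmf G. pmf G \<theta> * f \<theta> x)"

definition couplings :: "'t pmf \<Rightarrow> 't pmf \<Rightarrow> ('t \<times> 't) pmf set" where
  "couplings G G' = {q. map_pmf fst q = G \<and> map_pmf snd q = G'}"

text \<open>
  The integral against the discrete measure \<open>measure_pmf q\<close> is the sum of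
  \<open>pmf q (\<theta>, \<theta>') * f_divergence M \<phi> (f \<theta>) (f \<theta>')\<close> over all pairs of atoms;
  pairs of weight \<open>0\<close> do not contribute, even at infinite cost.
\<close>

definition composite_transport ::
    "'x measure \<Rightarrow> (real \<Rightarrow> real) \<Rightarrow> ('t \<Rightarrow> 'x \<Rightarrow> real) \<Rightarrow> 't pmf \<Rightarrow> 't pmf \<Rightarrow> ereal" where
  "composite_transport M \<phi> f G G' =
     (INF q\<in>couplings G G'.
        ext_integral (measure_pmf q) (\<lambda>(\<theta>, \<theta>'). f_divergence M \<phi> (f \<theta>) (f \<theta>')))"

end

theory Submission imports Defs begin

text \<open>
  On the nonnegative quadrant the integrand \<open>\<phi> (q / p) * p\<close>, with its conventions
  at \<open>p = 0\<close>, is the supremum of the linear forms \<open>a * p + b * q\<close> over the affine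
  minorants \<open>a + b * t\<close> of \<open>\<phi>\<close>; it is therefore jointly sublinear and satisfies
  Jensen's inequality for every coupling. Subtracting one fixed minorant makes the integrand
  nonnegative and changes every divergence between probability densities by the same constant
  \<open>a + b\<close>. Hence all comparisons take place between nonnegative integrals, where Tonelli's
  theorem exchanges the coupling with the dominating measure.
\<close>

section \<open>Affine minorants and the integrand of the divergence\<close>

lemma convex_supporting_line:
  fixes \<phi> :: "real \<Rightarrow> real"
  assumes "convex_on UNIV \<phi>"
  obtains b where "\<And>t. \<phi> x + b * (t - x) \<le> \<phi> t"
  by (rule that[OF convex_le_Inf_differential[OF assms]]) auto

text \<open>Up to the sign of \<open>a\<close>, this is the epigraph of the convex conjugate of
  \<open>\<phi>\<close>.\<close>

definition affine_minorants :: "(real \<Rightarrow> real) \<Rightarrow> (real \<times> real) set" where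
  "affine_minorants \<phi> = {(a, b). \<forall>t. a + b * t \<le> \<phi> t}"

lemma affine_minorant_touching:
  assumes "convex_on UNIV \<phi>"
  obtains a b where "(a, b) \<in> affine_minorants \<phi>" "\<phi> x = a + b * x"
proof -
  obtain b where "\<And>t. \<phi> x + b * (t - x) \<le> \<phi> t"
    using convex_supporting_line[OF assms, where x = x] by blast
  then show thesis
    by (intro that[of "\<phi> x - b * x" b]) (auto simp: affine_minorants_def algebra_simps)
qed

lemma tendsto_divide_add_ereal: "((\<lambda>t::real. ereal (c / t + d)) \<longlongrightarrow> ereal d) at_top"
proof -
  have "((\<lambda>t. c / t + d) \<longlongrightarrow> 0 + d) at_top"
    by (intro tendsto_add real_tendsto_divide_at_top[OF tendsto_const] filterlim_ident tendsto_const)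
  then show ?thesis by simp
qed

text \<open>Each minorant gives \<open>\<phi> t / t \<ge> a / t + b\<close> for t > 0, so the
  quotient eventually exceeds anything below b. Conversely, the minorant touching at t has intercept
  at most \<open>\<phi> 0\<close>, which bounds the quotient by \<open>\<phi> 0 / t\<close> plus the
  supremum of the slopes.\<close>

lemma Lim_slope_eq_SUP:
  assumes "convex_on UNIV \<phi>"
  shows "Lim at_top (\<lambda>t. ereal (\<phi> t / t)) = (SUP (a, b)\<in>affine_minorants \<phi>. ereal b)"
    (is "_ = ?S")
proof (rule tendsto_Lim)
  show "((\<lambda>t. ereal (\<phi> t / t)) \<longlongrightarrow> ?S) at_top"
  proof (rule order_tendstoI)
    fix y assume "y < ?S"
    then obtain a b where ab: "(a, b) \<in> affine_minorants \<phi>" and y: "y < ereal b"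
      by (auto simp: less_SUP_iff)
    have "\<forall>\<^sub>F t in at_top. y < ereal (a / t + b)"
      using tendsto_divide_add_ereal y by (rule order_tendstoD)
    then show "\<forall>\<^sub>F t in at_top. y < ereal (\<phi> t / t)"
      using eventually_gt_at_top[of 0]
    proof eventually_elim
      case (elim t)
      have "a + b * t \<le> \<phi> t" using ab by (auto simp: affine_minorants_def)
      then have "(a + b * t) / t \<le> \<phi> t / t" using elim(2) by (intro divide_right_mono) auto
      then have "a / t + b \<le> \<phi> t / t" using elim(2) by (simp add: add_divide_distrib)
      then show ?case using elim(1) by (metis ereal_less_eq(3) less_le_trans)
    qed
  next
    fix y assume y: "?S < y"
    \<comment> \<open>One minorant bounds \<open>?S\<close> from below and y bounds it from above,
      so \<open>?S\<close> is a real number.\<close>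
    obtain a0 b0 where "(a0, b0) \<in> affine_minorants \<phi>"
      using affine_minorant_touching[OF assms, of 0] by metis
    then have "ereal b0 \<le> ?S" by (intro SUP_upper2) auto
    with y obtain s where s: "?S = ereal s" by (cases ?S) auto
    have "\<forall>\<^sub>F t in at_top. ereal (\<phi> 0 / t + s) < y"
      using tendsto_divide_add_ereal y unfolding s by (rule order_tendstoD)
    then show "\<forall>\<^sub>F t in at_top. ereal (\<phi> t / t) < y"
      using eventually_gt_at_top[of 0]
    proof eventually_elim
      case (elim t)
      obtain a b where ab: "(a, b) \<in> affine_minorants \<phi>" "\<phi> t = a + b * t"
        using affine_minorant_touching[OF assms] by blast
      have "ereal b \<le> ?S" using ab by (intro SUP_upper2) auto
      then have "b \<le> s" using s by simp
      moreover have "a \<le> \<phi> 0" using ab by (auto simp: affine_minorants_def dest: spec[of _ 0])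
      ultimately have "\<phi> t / t \<le> \<phi> 0 / t + s"
        using elim ab(2) by (simp add: field_simps add_mono mult_right_mono)
      then show ?case using elim(1) by (metis ereal_less_eq(3) le_less_trans)
    qed
  qed
qed simp

text \<open>For p > 0 the supremum is attained by the line touching \<open>\<phi>\<close> at
  \<open>q / p\<close>. For p = 0 the forms reduce to \<open>b * q\<close>, and
  \<open>Lim_slope_eq_SUP\<close> identifies the limit in the convention with the supremum of the
  slopes.\<close>

lemma f_div_integrand_eq_SUP:
  assumes "convex_on UNIV \<phi>" "0 \<le> p" "0 \<le> q"
  shows "f_div_integrand \<phi> p q = (SUP (a, b)\<in>affine_minorants \<phi>. ereal (a * p + b * q))"
proof (cases "p = 0")
  case True
  \<comment> \<open>Nonemptiness lets the factor q move into the supremum even when q = 0, where the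
    supremum of the slopes may be infinite.\<close>
  have "affine_minorants \<phi> \<noteq> {}" using affine_minorant_touching[OF assms(1)] by blast
  then show ?thesis
    using assms True
    by (auto simp: f_div_integrand_def Lim_slope_eq_SUP Sup_ereal_mult_left' mult.commute
        split_beta intro!: SUP_cong)
next
  case False
  with assms have p: "p > 0" by simp
  obtain a b where ab: "(a, b) \<in> affine_minorants \<phi>" "\<phi> (q / p) = a + b * (q / p)"
    using affine_minorant_touching[OF assms(1)] by blast
  have "\<phi> (q / p) * p = a * p + b * q" using ab(2) p by (simp add: field_simps)
  then have "ereal (\<phi> (q / p) * p) \<le> (SUP (a, b)\<in>affine_minorants \<phi>. ereal (a * p + b * q))"
    using ab(1) by (intro SUP_upper2) auto
  moreover have "(SUP (a, b)\<in>affine_minorants \<phi>. ereal (a * p + b * q)) \<le> ereal (\<phi> (q / p) * p)"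
  proof (rule SUP_least, clarify)
    fix c d assume "(c, d) \<in> affine_minorants \<phi>"
    then have "c + d * (q / p) \<le> \<phi> (q / p)" unfolding affine_minorants_def by blast
    then have "(c + d * (q / p)) * p \<le> \<phi> (q / p) * p" using p by (intro mult_right_mono) auto
    moreover have "(c + d * (q / p)) * p = c * p + d * q" using p by (simp add: field_simps)
    ultimately show "ereal (c * p + d * q) \<le> ereal (\<phi> (q / p) * p)" by simp
  qed
  ultimately show ?thesis using p by (simp add: f_div_integrand_def order_antisym)
qed

lemma f_div_integrand_ge:
  assumes "convex_on UNIV \<phi>" "0 \<le> p" "0 \<le> q" "(a, b) \<in> affine_minorants \<phi>"
  shows "ereal (a * p + b * q) \<le> f_div_integrand \<phi> p q"
  unfolding f_div_integrand_eq_SUP[OF assms(1-3)] using assms(4) by (intro SUP_upper2) auto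

lemma f_div_integrand_measurable:
  assumes "convex_on UNIV \<phi>" and [measurable]: "p \<in> borel_measurable M" "q \<in> borel_measurable M"
  shows "(\<lambda>x. f_div_integrand \<phi> (p x) (q x)) \<in> borel_measurable M"
proof -
  have [measurable]: "\<phi> \<in> borel_measurable borel"
    using convex_on_continuous[OF open_UNIV assms(1)] by (rule borel_measurable_continuous_onI)
  show ?thesis unfolding f_div_integrand_def by measurable
qed

section \<open>Jensen's inequality for the excess over a minorant\<close>

text \<open>\<open>ennreal\<close> sends negative values to 0, so the right-hand side integrates the
  positive part of h.\<close>

lemma integral_le_nn_integral:
  fixes h :: "'a \<Rightarrow> real"
  assumes "integrable N h"
  shows "ennreal (\<integral>z. h z \<partial>N) \<le> (\<integral>\<^sup>+z. ennreal (h z) \<partial>N)"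
proof -
  have i: "integrable N (\<lambda>z. max 0 (h z))" using assms by simp
  have "ennreal (\<integral>z. h z \<partial>N) \<le> ennreal (\<integral>z. max 0 (h z) \<partial>N)"
    using assms i by (intro ennreal_leI integral_mono) auto
  also have "\<dots> = (\<integral>\<^sup>+z. ennreal (max 0 (h z)) \<partial>N)"
    using i by (intro nn_integral_eq_integral[symmetric]) auto
  also have "\<dots> = (\<integral>\<^sup>+z. ennreal (h z) \<partial>N)"
    by (intro nn_integral_cong) (simp add: max_def ennreal_neg)
  finally show ?thesis .
qed

text \<open>When \<open>(a, b)\<close> is a minorant and p, q are nonnegative, the difference is
  nonnegative by \<open>f_div_integrand_ge\<close>, so \<open>e2ennreal\<close> loses
  nothing.\<close>

definition excess :: "(real \<Rightarrow> real) \<Rightarrow> real \<Rightarrow> real \<Rightarrow> real \<Rightarrow> real \<Rightarrow> ennreal" where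
  "excess \<phi> a b p q = e2ennreal (f_div_integrand \<phi> p q - ereal (a * p + b * q))"

lemma excess_measurable:
  assumes "convex_on UNIV \<phi>" and [measurable]: "p \<in> borel_measurable M" "q \<in> borel_measurable M"
  shows "(\<lambda>x. excess \<phi> a b (p x) (q x)) \<in> borel_measurable M"
  unfolding excess_def using f_div_integrand_measurable[OF assms] by measurable

text \<open>By \<open>f_div_integrand_eq_SUP\<close> it suffices to treat one minorant
  \<open>(c, d)\<close> at a time. Its linear form commutes with the integral and has no constant
  term, so the total mass of N does not enter.\<close>

lemma excess_integral_le:
  assumes "convex_on UNIV \<phi>"
    and "integrable N p" "integrable N q" "AE z in N. 0 \<le> p z" "AE z in N. 0 \<le> q z"
  shows "excess \<phi> a b (\<integral>z. p z \<partial>N) (\<integral>z. q z \<partial>N) \<le> (\<integral>\<^sup>+z. excess \<phi> a b (p z) (q z) \<partial>N)"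
    (is "excess _ _ _ ?P ?Q \<le> ?R")
proof -
  have *: "f_div_integrand \<phi> ?P ?Q \<le> enn2ereal ?R + ereal (a * ?P + b * ?Q)"
  proof (subst f_div_integrand_eq_SUP)
    show "0 \<le> ?P" "0 \<le> ?Q" using assms by (auto intro: integral_nonneg_AE)
    show "(SUP (c, d)\<in>affine_minorants \<phi>. ereal (c * ?P + d * ?Q)) \<le> enn2ereal ?R + ereal (a * ?P + b * ?Q)"
    proof (rule SUP_least, clarify)
      fix c d assume cd: "(c, d) \<in> affine_minorants \<phi>"
      \<comment> \<open>The part of the form \<open>(c, d)\<close> above the form
        \<open>(a, b)\<close>; pointwise it is at most the excess.\<close>
      let ?h = "\<lambda>z. (c - a) * p z + (d - b) * q z"
      have "(c - a) * ?P + (d - b) * ?Q = (\<integral>z. ?h z \<partial>N)"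
        using assms by simp
      also have "ennreal \<dots> \<le> (\<integral>\<^sup>+z. ennreal (?h z) \<partial>N)"
        using assms by (intro integral_le_nn_integral) simp
      also have "\<dots> \<le> ?R"
      proof (rule nn_integral_mono_AE)
        show "AE z in N. ennreal (?h z) \<le> excess \<phi> a b (p z) (q z)"
          using assms(4,5)
        proof eventually_elim
          case (elim z)
          have "ereal (c * p z + d * q z) \<le> f_div_integrand \<phi> (p z) (q z)"
            using f_div_integrand_ge[OF assms(1) elim cd] .
          then have "ereal (?h z) \<le> f_div_integrand \<phi> (p z) (q z) - ereal (a * p z + b * q z)"
            by (cases "f_div_integrand \<phi> (p z) (q z)") (auto simp: algebra_simps)
          then show ?case unfolding excess_def by (metis e2ennreal_ereal e2ennreal_mono)
        qed
      qed
      \<comment> \<open>If the left-hand side is negative, \<open>ennreal\<close> has cut it to 0,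
        and the claim holds because \<open>?R\<close> is nonnegative.\<close>
      finally have "ereal ((c - a) * ?P + (d - b) * ?Q) \<le> enn2ereal ?R"
        by (metis e2ennreal_ereal enn2ereal_e2ennreal enn2ereal_nonneg le_cases
              less_eq_ennreal.rep_eq order_trans)
      then show "ereal (c * ?P + d * ?Q) \<le> enn2ereal ?R + ereal (a * ?P + b * ?Q)"
        by (cases "enn2ereal ?R") (auto simp: algebra_simps)
    qed
  qed fact
  then have "f_div_integrand \<phi> ?P ?Q - ereal (a * ?P + b * ?Q) \<le> enn2ereal ?R"
    by (simp add: ereal_minus_le)
  then show ?thesis unfolding excess_def by (metis e2ennreal_enn2ereal e2ennreal_mono)
qed

section \<open>Extended integrals as nonnegative integrals plus a constant\<close>

text \<open>With ^+ and ^- for positive and negative parts, g^+ + h^- = (g - h) + h^+ + g^- holds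
  almost everywhere. All terms are nonnegative, so the identity integrates even when some integrals
  are infinite; those of h^+, h^- and g^- are finite and can be moved across.\<close>

lemma ext_integral_eq_excess:
  fixes g :: "'a \<Rightarrow> ereal" and h :: "'a \<Rightarrow> real"
  assumes [measurable]: "g \<in> borel_measurable N" and h: "integrable N h"
    and le: "AE x in N. ereal (h x) \<le> g x"
  shows "ext_integral N g = enn2ereal (\<integral>\<^sup>+x. e2ennreal (g x - ereal (h x)) \<partial>N) + ereal (\<integral>x. h x \<partial>N)"
proof -
  have [measurable]: "h \<in> borel_measurable N" using h by simp
  let ?A = "\<integral>\<^sup>+x. e2ennreal (g x) \<partial>N" and ?E = "\<integral>\<^sup>+x. e2ennreal (- g x) \<partial>N"
    and ?B = "\<integral>\<^sup>+x. ennreal (h x) \<partial>N" and ?C = "\<integral>\<^sup>+x. ennreal (- h x) \<partial>N"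
    and ?D = "\<integral>\<^sup>+x. e2ennreal (g x - ereal (h x)) \<partial>N"
  have "?A + ?C = (\<integral>\<^sup>+x. e2ennreal (g x) + ennreal (- h x) \<partial>N)"
    by (simp add: nn_integral_add)
  also have "\<dots> = (\<integral>\<^sup>+x. e2ennreal (g x - ereal (h x)) + ennreal (h x) + e2ennreal (- g x) \<partial>N)"
  proof (rule nn_integral_cong_AE)
    show "AE x in N. e2ennreal (g x) + ennreal (- h x)
            = e2ennreal (g x - ereal (h x)) + ennreal (h x) + e2ennreal (- g x)"
      using le
    proof eventually_elim
      case (elim x)
      show ?case
      proof (cases "g x")
        case (real r)
        with elim have "h x \<le> r" by simp
        then show ?thesis using real
          by (cases "0 \<le> r"; cases "0 \<le> h x") (auto simp: ennreal_neg simp flip: ennreal_plus)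
      qed (use elim in \<open>auto simp: e2ennreal_neg\<close>)
    qed
  qed
  also have "\<dots> = ?D + ?B + ?E"
    by (simp add: nn_integral_add)
  finally have eq: "?A + ?C = ?D + ?B + ?E" .
  \<comment> \<open>The integrable lower bound h makes the negative part of g integrable, so
    \<open>ext_integral\<close> never subtracts infinity here.\<close>
  have "?E \<le> ?C"
  proof (rule nn_integral_mono_AE)
    show "AE x in N. e2ennreal (- g x) \<le> ennreal (- h x)"
      using le
    proof eventually_elim
      case (elim x)
      then have "- g x \<le> ereal (- h x)" using ereal_minus_le_minus by fastforce
      then show ?case by (metis e2ennreal_ereal e2ennreal_mono)
    qed
  qed
  moreover have "?B \<noteq> \<infinity>" "?C \<noteq> \<infinity>"
    using h unfolding real_integrable_def by auto
  ultimately obtain rB rC rE where r: "0 \<le> rB" "0 \<le> rC" "0 \<le> rE"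
      "?B = ennreal rB" "?C = ennreal rC" "?E = ennreal rE"
    by (metis ennreal_cases infinity_ennreal_def top.extremum_uniqueI)
  have hi: "(\<integral>x. h x \<partial>N) = rB - rC"
    using real_lebesgue_integral_def[OF h] r by simp
  show ?thesis
  proof (cases ?D)
    case top
    \<comment> \<open>Since \<open>?C\<close> is finite, \<open>?A\<close> must absorb the infinite
      \<open>?D\<close>, and both sides of the claim are infinite.\<close>
    with eq r have "?A = top" by (metis add_top ennreal_add_eq_top ennreal_neq_top)
    with top show ?thesis by (simp add: ext_integral_def r enn2ereal_ennreal)
  next
    case (real d)
    then have eq': "?A + ennreal rC = ennreal (d + rB + rE)"
      using eq r by (simp add: ennreal_plus)
    then obtain a where a: "?A = ennreal a" "0 \<le> a"
      by (metis ennreal_add_eq_top ennreal_cases ennreal_neq_top)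
    then have "a + rC = d + rB + rE" using eq' r real by (simp flip: ennreal_plus)
    with a real show ?thesis by (simp add: ext_integral_def r enn2ereal_ennreal hi)
  qed
qed

text \<open>The lower bound \<open>a * p x + b * q x\<close> integrates to \<open>a + b\<close>
  because each density has mass 1.\<close>

lemma f_divergence_eq_excess:
  assumes "convex_on UNIV \<phi>" "(a, b) \<in> affine_minorants \<phi>" "prob_density M p" "prob_density M q"
  shows "f_divergence M \<phi> p q = enn2ereal (\<integral>\<^sup>+x. excess \<phi> a b (p x) (q x) \<partial>M) + ereal (a + b)"
proof -
  have i: "integrable M r" "(\<integral>x. r x \<partial>M) = 1" if "prob_density M r" for r
  proof -
    have "(\<integral>\<^sup>+x. ennreal (r x) \<partial>M) = ennreal 1" "r \<in> borel_measurable M" "AE x in M. 0 \<le> r x"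
      using that by (auto simp: prob_density_def)
    then show "integrable M r" "(\<integral>x. r x \<partial>M) = 1"
      by (auto intro: integrableI_nn_integral_finite simp: integral_eq_nn_integral)
  qed
  have "ext_integral M (\<lambda>x. f_div_integrand \<phi> (p x) (q x))
      = enn2ereal (\<integral>\<^sup>+x. e2ennreal (f_div_integrand \<phi> (p x) (q x) - ereal (a * p x + b * q x)) \<partial>M)
        + ereal (\<integral>x. a * p x + b * q x \<partial>M)"
  proof (rule ext_integral_eq_excess)
    show "(\<lambda>x. f_div_integrand \<phi> (p x) (q x)) \<in> borel_measurable M"
      using assms by (intro f_div_integrand_measurable) (simp_all add: prob_density_def)
    show "integrable M (\<lambda>x. a * p x + b * q x)"
      using assms(3,4) by (simp add: i)
    show "AE x in M. ereal (a * p x + b * q x) \<le> f_div_integrand \<phi> (p x) (q x)"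
      using assms by (intro AE_I2 f_div_integrand_ge) (simp_all add: prob_density_def)
  qed
  then show ?thesis using assms i by (simp add: f_divergence_def excess_def)
qed

section \<open>Exchange of discrete sums with the dominating measure\<close>

text \<open>Passing to the support gives a countable index set, and hypotheses on the summands are
  then required only at atoms.\<close>

lemma nn_integral_pmf_eq_count_space:
  "(\<integral>\<^sup>+z. f z \<partial>measure_pmf q) = (\<integral>\<^sup>+z. ennreal (pmf q z) * f z \<partial>count_space (set_pmf q))"
  unfolding nn_integral_measure_pmf
  by (rule nn_integral_count_space_eq) (auto simp: set_pmf_iff)

text \<open>\<open>M\<close> need not be \<open>\<sigma>\<close>-finite, so the exchange relies on the countable support.\<close>

lemma nn_integral_pmf_swap:
  assumes [measurable]: "\<And>z. z \<in> set_pmf q \<Longrightarrow> F z \<in> borel_measurable M"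
  shows "(\<integral>\<^sup>+x. \<integral>\<^sup>+z. F z x \<partial>measure_pmf q \<partial>M) = (\<integral>\<^sup>+z. \<integral>\<^sup>+x. F z x \<partial>M \<partial>measure_pmf q)"
  unfolding nn_integral_pmf_eq_count_space
  by (subst nn_integral_count_space_nn_integral) (auto simp: nn_integral_cmult intro!: nn_integral_cong)

text \<open>On the countable support, measurable sections give a jointly measurable function, and
  \<open>count_space\<close> is sigma-finite there.\<close>

lemma borel_measurable_nn_integral_pmf:
  assumes "\<And>z. z \<in> set_pmf q \<Longrightarrow> F z \<in> borel_measurable M"
  shows "(\<lambda>x. \<integral>\<^sup>+z. F z x \<partial>measure_pmf q) \<in> borel_measurable M"
proof -
  interpret sigma_finite_measure "count_space (set_pmf q)"
    by (rule sigma_finite_measure_count_space_countable) simp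
  have "(\<lambda>(z, x). ennreal (pmf q z) * F z x) \<in> borel_measurable (count_space (set_pmf q) \<Otimes>\<^sub>M M)"
    using assms by (intro measurable_pair_measure_countable1) auto
  from measurable_pair_swap[OF this] show ?thesis
    unfolding nn_integral_pmf_eq_count_space
    by (intro borel_measurable_nn_integral) (simp add: split_beta')
qed

section \<open>Mixture densities as integrals over the mixing measure\<close>

text \<open>The default values agree: where the sum diverges, \<open>infsum\<close> is 0 and so is
  \<open>enn2real\<close> of infinity.\<close>

lemma mixture_density_eq_enn2real:
  assumes "\<And>\<theta>. \<theta> \<in> set_pmf G \<Longrightarrow> 0 \<le> f \<theta> x"
  shows "mixture_density f G x = enn2real (\<integral>\<^sup>+\<theta>. ennreal (f \<theta> x) \<partial>measure_pmf G)"
proof -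
  let ?g = "\<lambda>\<theta>. pmf G \<theta> * f \<theta> x" and ?A = "set_pmf G"
  have "infsum ?g ?A = infsetsum ?g ?A"
  proof (cases "?g summable_on ?A")
    case True
    then have "(\<lambda>\<theta>. norm (?g \<theta>)) summable_on ?A"
      using assms by (subst summable_on_cong[where g = ?g]) auto
    then have "Infinite_Set_Sum.abs_summable_on ?g ?A"
      unfolding abs_summable_equivalent .
    then show ?thesis by (rule infsetsum_infsum[symmetric])
  next
    case False
    \<comment> \<open>Both notions of sum now fall back to the value 0.\<close>
    then have "\<not> Infinite_Set_Sum.abs_summable_on ?g ?A"
      using abs_summable_summable abs_summable_equivalent by blast
    with False show ?thesis
      by (simp add: infsum_not_exists not_summable_infsetsum_eq)
  qed
  also have "\<dots> = enn2real (\<integral>\<^sup>+\<theta>. ennreal (?g \<theta>) \<partial>count_space ?A)"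
    unfolding infsetsum_def using assms
    by (intro integral_eq_nn_integral) (auto simp: AE_count_space)
  also have "(\<integral>\<^sup>+\<theta>. ennreal (?g \<theta>) \<partial>count_space ?A) = (\<integral>\<^sup>+\<theta>. ennreal (f \<theta> x) \<partial>measure_pmf G)"
    unfolding nn_integral_pmf_eq_count_space
    by (intro nn_integral_cong) (simp add: ennreal_mult')
  finally show ?thesis by (simp add: mixture_density_def)
qed

text \<open>Exchanging the integrals shows that \<open>?I\<close> has integral 1, hence is finite
  almost everywhere. This yields mass 1 and almost everywhere integrability; the last equation holds
  at every point, because a divergent integral is also 0.\<close>

lemma
  assumes "\<And>\<theta>. \<theta> \<in> set_pmf G \<Longrightarrow> prob_density M (f \<theta>)"
  shows prob_density_mixture: "prob_density M (mixture_density f G)"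
    and AE_integrable_mixture: "AE x in M. integrable (measure_pmf G) (\<lambda>\<theta>. f \<theta> x)"
    and mixture_density_eq_integral:
      "x \<in> space M \<Longrightarrow> mixture_density f G x = (\<integral>\<theta>. f \<theta> x \<partial>measure_pmf G)"
proof -
  let ?I = "\<lambda>x. \<integral>\<^sup>+\<theta>. ennreal (f \<theta> x) \<partial>measure_pmf G"
  have eq: "mixture_density f G x = enn2real (?I x)" if "x \<in> space M" for x
    using assms that by (intro mixture_density_eq_enn2real) (auto simp: prob_density_def)
  have I [measurable]: "?I \<in> borel_measurable M"
    using assms by (intro borel_measurable_nn_integral_pmf) (auto simp: prob_density_def)
  have "(\<integral>\<^sup>+x. ?I x \<partial>M) = (\<integral>\<^sup>+\<theta>. \<integral>\<^sup>+x. ennreal (f \<theta> x) \<partial>M \<partial>measure_pmf G)"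
    using assms by (intro nn_integral_pmf_swap) (auto simp: prob_density_def)
  also have "\<dots> = (\<integral>\<^sup>+\<theta>. 1 \<partial>measure_pmf G)"
    using assms by (intro nn_integral_cong_AE) (auto simp: prob_density_def AE_measure_pmf_iff)
  finally have int: "(\<integral>\<^sup>+x. ?I x \<partial>M) = 1"
    by (simp add: measure_pmf.emeasure_space_1[simplified])
  then have fin: "AE x in M. ?I x \<noteq> \<infinity>"
    by (intro nn_integral_PInf_AE) auto
  have "(\<integral>\<^sup>+x. ennreal (mixture_density f G x) \<partial>M) = (\<integral>\<^sup>+x. ?I x \<partial>M)"
    using fin by (intro nn_integral_cong_AE) (auto simp: eq less_top)
  moreover have "mixture_density f G \<in> borel_measurable M"
    by (subst measurable_cong[OF eq]) auto
  ultimately show "prob_density M (mixture_density f G)"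
    using int by (auto simp: prob_density_def eq)
  show "AE x in M. integrable (measure_pmf G) (\<lambda>\<theta>. f \<theta> x)"
    using fin AE_space
  proof eventually_elim
    case (elim x)
    then show ?case
      using assms by (intro integrableI_nonneg) (auto simp: prob_density_def AE_measure_pmf_iff less_top)
  qed
  show "mixture_density f G x = (\<integral>\<theta>. f \<theta> x \<partial>measure_pmf G)" if "x \<in> space M"
    using assms that
    by (subst integral_eq_nn_integral) (auto simp: eq prob_density_def AE_measure_pmf_iff)
qed

section \<open>The comparison for a single coupling\<close>

lemma f_divergence_mixture_le_coupling:
  assumes cvx: "convex_on UNIV \<phi>" and q: "q \<in> couplings G G'"
    and G: "\<And>\<theta>. \<theta> \<in> set_pmf G \<Longrightarrow> prob_density M (f \<theta>)"
    and G': "\<And>\<theta>. \<theta> \<in> set_pmf G' \<Longrightarrow> prob_density M (f \<theta>)"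
  shows "f_divergence M \<phi> (mixture_density f G) (mixture_density f G')
    \<le> ext_integral (measure_pmf q) (\<lambda>(\<theta>, \<theta>'). f_divergence M \<phi> (f \<theta>) (f \<theta>'))"
proof -
  \<comment> \<open>Any fixed minorant serves; the touching point 0 is an arbitrary choice.\<close>
  obtain a b where ab: "(a, b) \<in> affine_minorants \<phi>"
    using affine_minorant_touching[OF cvx, of 0] by metis
  let ?P = "mixture_density f G" and ?Q = "mixture_density f G'"
  let ?D = "\<lambda>z. \<integral>\<^sup>+x. excess \<phi> a b (f (fst z) x) (f (snd z) x) \<partial>M"
  have qG: "G = map_pmf fst q" and qG': "G' = map_pmf snd q"
    using q by (auto simp: couplings_def)
  have d: "prob_density M (f (fst z))" "prob_density M (f (snd z))" if "z \<in> set_pmf q" for z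
    using that G G' by (auto simp: qG qG')
  have int: "AE x in M. integrable (measure_pmf G) (\<lambda>\<theta>. f \<theta> x)"
      "AE x in M. integrable (measure_pmf G') (\<lambda>\<theta>. f \<theta> x)"
    using AE_integrable_mixture[of G M f] AE_integrable_mixture[of G' M f] G G' by blast+
  \<comment> \<open>The marginals of q turn both mixtures into averages under one common measure, as
    Jensen's inequality requires.\<close>
  have eq: "?P x = (\<integral>z. f (fst z) x \<partial>measure_pmf q)" "?Q x = (\<integral>z. f (snd z) x \<partial>measure_pmf q)"
    if "x \<in> space M" for x
    using mixture_density_eq_integral[of G M f x, OF G that] mixture_density_eq_integral[of G' M f x, OF G' that]
    by (simp_all add: qG qG')
  have "(\<integral>\<^sup>+x. excess \<phi> a b (?P x) (?Q x) \<partial>M)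
      \<le> (\<integral>\<^sup>+x. \<integral>\<^sup>+z. excess \<phi> a b (f (fst z) x) (f (snd z) x) \<partial>measure_pmf q \<partial>M)"
  proof (rule nn_integral_mono_AE)
    show "AE x in M. excess \<phi> a b (?P x) (?Q x)
        \<le> (\<integral>\<^sup>+z. excess \<phi> a b (f (fst z) x) (f (snd z) x) \<partial>measure_pmf q)"
      using int AE_space
    proof eventually_elim
      case (elim x)
      have "integrable (measure_pmf q) (\<lambda>z. f (fst z) x)" "integrable (measure_pmf q) (\<lambda>z. f (snd z) x)"
        using elim by (simp_all add: qG qG')
      then show ?case
        unfolding eq[OF elim(3)] using cvx d elim(3)
        by (intro excess_integral_le) (auto simp: AE_measure_pmf_iff prob_density_def)
    qed
  qed
  also have "\<dots> = (\<integral>\<^sup>+z. ?D z \<partial>measure_pmf q)"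
    using d cvx by (intro nn_integral_pmf_swap excess_measurable) (auto simp: prob_density_def)
  finally have le: "(\<integral>\<^sup>+x. excess \<phi> a b (?P x) (?Q x) \<partial>M) \<le> (\<integral>\<^sup>+z. ?D z \<partial>measure_pmf q)" .
  let ?g = "\<lambda>(\<theta>, \<theta>'). f_divergence M \<phi> (f \<theta>) (f \<theta>')"
  have g: "?g z = enn2ereal (?D z) + ereal (a + b)" if "z \<in> set_pmf q" for z
    using f_divergence_eq_excess[OF cvx ab d[OF that]] by (simp add: split_beta)
  \<comment> \<open>The transport cost is normalized in the same way, now over q with the constant
    lower bound \<open>a + b\<close>; since q has mass 1, the same constant reappears.\<close>
  have "ext_integral (measure_pmf q) ?g
      = enn2ereal (\<integral>\<^sup>+z. e2ennreal (?g z - ereal (a + b)) \<partial>measure_pmf q)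
        + ereal (\<integral>z. a + b \<partial>measure_pmf q)"
  proof (rule ext_integral_eq_excess)
    show "AE z in measure_pmf q. ereal (a + b) \<le> ?g z"
      unfolding AE_measure_pmf_iff
    proof
      fix z assume "z \<in> set_pmf q"
      then have "?g z = enn2ereal (?D z) + ereal (a + b)" by (rule g)
      also have "\<dots> \<ge> 0 + ereal (a + b)" by (intro add_right_mono) simp
      finally show "ereal (a + b) \<le> ?g z" by simp
    qed
  qed auto
  also have "(\<integral>\<^sup>+z. e2ennreal (?g z - ereal (a + b)) \<partial>measure_pmf q) = (\<integral>\<^sup>+z. ?D z \<partial>measure_pmf q)"
  proof (intro nn_integral_cong_AE, unfold AE_measure_pmf_iff, rule)
    fix z assume "z \<in> set_pmf q"
    then have "?g z - ereal (a + b) = enn2ereal (?D z)"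
      by (subst g) (auto simp: ereal_diff_add_inverse add.commute)
    then show "e2ennreal (?g z - ereal (a + b)) = ?D z" by simp
  qed
  finally have "ext_integral (measure_pmf q) ?g = enn2ereal (\<integral>\<^sup>+z. ?D z \<partial>measure_pmf q) + ereal (a + b)"
    by simp
  moreover have "f_divergence M \<phi> ?P ?Q
      = enn2ereal (\<integral>\<^sup>+x. excess \<phi> a b (?P x) (?Q x) \<partial>M) + ereal (a + b)"
    by (intro f_divergence_eq_excess prob_density_mixture cvx ab G G')
  \<comment> \<open>Both sides carry the same real summand \<open>a + b\<close>, so
    \<open>le\<close> passes to the original quantities.\<close>
  ultimately show ?thesis
    using le by (simp add: add_right_mono less_eq_ennreal.rep_eq)
qed

theorem lemma1:
  fixes M :: "'x measure"
    and \<Theta> :: "'t set"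
    and f :: "'t \<Rightarrow> 'x \<Rightarrow> real"
    and \<phi> :: "real \<Rightarrow> real"
    and G G' :: "'t pmf"
  assumes "\<And>\<theta>. \<theta> \<in> \<Theta> \<Longrightarrow> prob_density M (f \<theta>)"
    and "convex_on UNIV \<phi>"
    and "G \<in> discrete_measures \<Theta>" and "G' \<in> discrete_measures \<Theta>"
    and "\<bar>f_divergence M \<phi> (mixture_density f G) (mixture_density f G')\<bar> \<noteq> \<infinity>"
    and "\<bar>composite_transport M \<phi> f G G'\<bar> \<noteq> \<infinity>"
  shows "f_divergence M \<phi> (mixture_density f G) (mixture_density f G')
           \<le> composite_transport M \<phi> f G G'"
  unfolding composite_transport_def
proof (rule INF_greatest)
  fix q assume "q \<in> couplings G G'"
  then show "f_divergence M \<phi> (mixture_density f G) (mixture_density f G')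
    \<le> ext_integral (measure_pmf q) (\<lambda>(\<theta>, \<theta>'). f_divergence M \<phi> (f \<theta>) (f \<theta>'))"
    using assms(1-4) by (intro f_divergence_mixture_le_coupling) (auto simp: discrete_measures_def)
qed

end
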